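(* For every integer $n \geq 2$, $$S_{2^{n}\otimes 2^{n}} = \frac{1}{2^{n}} \sum_{i_{1},i_{2},\ldots,i_{n}=0}^{3} (\sigma_{i_{1}} \otimes \sigma_{i_{2}} \otimes \cdots \otimes \sigma_{i_{n}}) \otimes (\sigma_{i_{1}} \otimes \sigma_{i_{2}} \otimes \cdots \otimes \sigma_{i_{n}}),$$ where $S_{2^n\otimes 2^n}$ is the tensor commutation matrix $2^n\otimes 2^n$, $\sigma_0$ is the $2\times 2$ identity matrix and $\sigma_1,\sigma_2,\sigma_3$ are the Pauli matrices.
   Context: All matrices have complex entries and $\otimes$ denotes the tensor (Kronecker) product of matrices. For an integer $m \geq 2$, the tensor commutation matrix $m\otimes m$, denoted $S_{m\otimes m}$, is the $m^2\times m^2$ permutation matrix such that $S_{m\otimes m}(a\otimes b) = b\otimes a$ for all column vectors $a,b\in \mathbf{C}^{m\times 1}$. The matrices $\sigma_i$ are $$\sigma_0 = I_2=\begin{pmatrix}1&0\\0&1\end{pmatrix},\quad \sigma_1=\begin{pmatrix}0&1\\1&0\end{pmatrix},\quad \sigma_2=\begin{pmatrix}0&-i\\i&0\end{pmatrix},\quad \sigma_3=\begin{pmatrix}1&0\\0&-1\end{pmatrix},$$ where in $\sigma_2$ the symbol $i$ is the imaginary unit. *)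

theory Defs
  imports Complex_Main "HOL-Combinatorics.Permutations" "Jordan_Normal_Form.Matrix"
begin

definition kronecker :: "complex mat \<Rightarrow> complex mat \<Rightarrow> complex mat" (infixr \<open>\<otimes>\<^sub>m\<close> 72) where
  "A \<otimes>\<^sub>m B = mat (dim_row A * dim_row B) (dim_col A * dim_col B)
     (\<lambda>(i, j). A $$ (i div dim_row B, j div dim_col B) * B $$ (i mod dim_row B, j mod dim_col B))"

primrec kronecker_list :: "complex mat list \<Rightarrow> complex mat" where
  "kronecker_list [] = 1\<^sub>m 1"
| "kronecker_list (A # As) = A \<otimes>\<^sub>m kronecker_list As"

definition is_permutation_mat :: "nat \<Rightarrow> complex mat \<Rightarrow> bool" where
  "is_permutation_mat d P \<longleftrightarrow>
     (\<exists>p. p permutes {0..<d} \<and> P = mat d d (\<lambda>(i, j). if i = p j then 1 else 0))"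

definition is_tensor_commutation_mat :: "nat \<Rightarrow> complex mat \<Rightarrow> bool" where
  "is_tensor_commutation_mat m S \<longleftrightarrow>
     is_permutation_mat (m\<^sup>2) S \<and>
     (\<forall>a \<in> carrier_mat m 1. \<forall>b \<in> carrier_mat m 1. S * (a \<otimes>\<^sub>m b) = b \<otimes>\<^sub>m a)"

(* Well-defined for every m, see ex1_tensor_commutation_mat below. *)
definition tensor_commutation_mat :: "nat \<Rightarrow> complex mat" where
  "tensor_commutation_mat m = (THE S. is_tensor_commutation_mat m S)"

(* Only the indices 0, 1, 2, 3 are meaningful. *)
definition pauli :: "nat \<Rightarrow> complex mat" where
  "pauli i =
     [1\<^sub>m 2,
      mat_of_rows_list 2 [[0, 1], [1, 0]],
      mat_of_rows_list 2 [[0, - \<i>], [\<i>, 0]],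
      mat_of_rows_list 2 [[1, 0], [0, - 1]]] ! i"


lemma dim_kronecker [simp]:
  "dim_row (A \<otimes>\<^sub>m B) = dim_row A * dim_row B"
  "dim_col (A \<otimes>\<^sub>m B) = dim_col A * dim_col B"
  by (simp_all add: kronecker_def)

lemma kronecker_carrier:
  "A \<in> carrier_mat r c \<Longrightarrow> B \<in> carrier_mat r' c' \<Longrightarrow> A \<otimes>\<^sub>m B \<in> carrier_mat (r * r') (c * c')"
  by auto

lemma kronecker_index:
  "i < dim_row A * dim_row B \<Longrightarrow> j < dim_col A * dim_col B \<Longrightarrow>
   (A \<otimes>\<^sub>m B) $$ (i, j) =
     A $$ (i div dim_row B, j div dim_col B) * B $$ (i mod dim_row B, j mod dim_col B)"
  by (simp add: kronecker_def)

lemma kronecker_list_singleton: "kronecker_list [A] = A"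
  by (rule eq_matI) (auto simp: kronecker_index)

lemma kronecker_assoc: "(A \<otimes>\<^sub>m B) \<otimes>\<^sub>m C = A \<otimes>\<^sub>m (B \<otimes>\<^sub>m C)"
proof (rule eq_matI)
  fix i j
  assume "i < dim_row (A \<otimes>\<^sub>m (B \<otimes>\<^sub>m C))" "j < dim_col (A \<otimes>\<^sub>m (B \<otimes>\<^sub>m C))"
  then have i: "i < dim_row A * dim_row B * dim_row C"
    and j: "j < dim_col A * dim_col B * dim_col C"
    by (simp_all add: mult.assoc)
  have *: "x div c < a * b \<and> x mod (b * c) < b * c \<and>
      x div c div b = x div (b * c) \<and> x div c mod b = x mod (b * c) div c \<and>
      x mod (b * c) mod c = x mod c" if x: "x < a * b * c" for x a b c :: nat
  proof -
    have "b > 0" "c > 0" using x by (auto intro!: Nat.gr0I)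
    have "x mod (b * c) = c * (x div c mod b) + x mod c"
      by (metis mod_mult2_eq mult.commute)
    then have "x mod (b * c) div c = x div c mod b" "x mod (b * c) mod c = x mod c"
      using \<open>c > 0\<close> by simp_all
    moreover have "x div c div b = x div (b * c)"
      by (metis div_mult2_eq mult.commute)
    moreover have "x div c < a * b" using x by (simp add: less_mult_imp_div_less)
    ultimately show ?thesis
      using \<open>b > 0\<close> \<open>c > 0\<close> by simp
  qed
  show "((A \<otimes>\<^sub>m B) \<otimes>\<^sub>m C) $$ (i, j) = (A \<otimes>\<^sub>m (B \<otimes>\<^sub>m C)) $$ (i, j)"
    using *[OF i] *[OF j] i j by (simp add: kronecker_index mult.assoc)
qed (simp_all add: mult.assoc)

lemma pauli_carrier: "i \<le> 3 \<Longrightarrow> pauli i \<in> carrier_mat 2 2"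
  by (auto simp: pauli_def mat_of_rows_list_def le_Suc_eq numeral_eq_Suc)

lemma kronecker_list_pauli_carrier:
  "set ks \<subseteq> {0..3} \<Longrightarrow>
   kronecker_list (map pauli ks) \<in> carrier_mat (2 ^ length ks) (2 ^ length ks)"
  by (induction ks) (use pauli_carrier in \<open>auto intro!: kronecker_carrier\<close>)

lemma ex1_tensor_commutation_mat: "\<exists>!S. is_tensor_commutation_mat m S"
proof (rule ex_ex1I)
  define p where "p j = (if j < m * m then (j mod m) * m + j div m else j)" for j
  define S :: "complex mat" where
    "S = mat (m * m) (m * m) (\<lambda>(i, j). if i = p j then 1 else 0)"
  have p: "p j < m * m \<and> p j div m = j mod m \<and> p j mod m = j div m \<and> p (p j) = j"
    if j: "j < m * m" for j
  proof -
    have m: "m > 0" using j by (auto intro!: Nat.gr0I)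
    have d: "j div m < m" using j by (simp add: less_mult_imp_div_less)
    have "(j mod m) * m + j div m < (j mod m) * m + m" using d by simp
    also have "\<dots> = Suc (j mod m) * m" by simp
    also have "\<dots> \<le> m * m" using m by (intro mult_right_mono) (auto simp: Suc_le_eq)
    finally have l: "p j < m * m" using j by (simp add: p_def)
    have "p j div m = j mod m" "p j mod m = j div m" using j d m by (simp_all add: p_def)
    moreover from this l have "p (p j) = j" by (simp add: p_def[of "p j"])
    ultimately show ?thesis using l by blast
  qed
  have pp: "p (p j) = j" for j using p[of j] by (cases "j < m * m") (auto simp: p_def)
  have "p permutes {0..<m * m}"
    unfolding permutes_def
  proof (intro conjI allI impI)
    fix y show "\<exists>!x. p x = y" by (metis pp)
  qed (simp add: p_def)
  then have "is_permutation_mat (m\<^sup>2) S"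
    unfolding is_permutation_mat_def S_def power2_eq_square by blast
  moreover have "S * (a \<otimes>\<^sub>m b) = b \<otimes>\<^sub>m a"
    if a: "a \<in> carrier_mat m 1" and b: "b \<in> carrier_mat m 1" for a b
  proof (rule eq_matI)
    fix i j assume "i < dim_row (b \<otimes>\<^sub>m a)" "j < dim_col (b \<otimes>\<^sub>m a)"
    then have i: "i < m * m" and j: "j = 0" using a b by auto
    have eq: "i = p k \<longleftrightarrow> k = p i" for k by (metis pp)
    have "(S * (a \<otimes>\<^sub>m b)) $$ (i, j) =
        (\<Sum>k = 0..<m * m. (if k = p i then 1 else 0) * (a \<otimes>\<^sub>m b) $$ (k, 0))"
      using i j a b by (simp add: scalar_prod_def S_def eq)
    also have "\<dots> = (\<Sum>k = 0..<m * m. if k = p i then (a \<otimes>\<^sub>m b) $$ (k, 0) else 0)"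
      by (intro sum.cong) auto
    also have "\<dots> = (a \<otimes>\<^sub>m b) $$ (p i, 0)" using p[OF i] by simp
    also have "\<dots> = (b \<otimes>\<^sub>m a) $$ (i, j)" using p[OF i] i j a b by (simp add: kronecker_index)
    finally show "(S * (a \<otimes>\<^sub>m b)) $$ (i, j) = (b \<otimes>\<^sub>m a) $$ (i, j)" .
  qed (use a b in \<open>auto simp: S_def\<close>)
  ultimately show "\<exists>S. is_tensor_commutation_mat m S"
    unfolding is_tensor_commutation_mat_def by blast
next
  fix S T assume S: "is_tensor_commutation_mat m S" and T: "is_tensor_commutation_mat m T"
  have c: "S \<in> carrier_mat (m * m) (m * m)" "T \<in> carrier_mat (m * m) (m * m)"
    using S T
    by (auto simp: is_tensor_commutation_mat_def is_permutation_mat_def power2_eq_square)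
  define e :: "nat \<Rightarrow> complex mat" where
    "e k = mat m 1 (\<lambda>(i, j). if i = k then 1 else 0)" for k
  show "S = T"
  proof (rule eq_matI)
    fix i j assume "i < dim_row T" "j < dim_col T"
    then have i: "i < m * m" and j: "j < m * m" using c by auto
    let ?E = "e (j div m) \<otimes>\<^sub>m e (j mod m)"
    have m: "m > 0" using j by (auto intro!: Nat.gr0I)
    have col: "(X * ?E) $$ (i, 0) = X $$ (i, j)" if X: "X \<in> carrier_mat (m * m) (m * m)" for X
    proof -
      have E: "?E $$ (k, 0) = (if k = j then 1 else 0)" if "k < m * m" for k
      proof -
        have "k = j \<longleftrightarrow> k div m = j div m \<and> k mod m = j mod m" by (metis div_mult_mod_eq)
        then show ?thesis
          using that m by (auto simp: kronecker_index e_def less_mult_imp_div_less)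
      qed
      have "(X * ?E) $$ (i, 0) = (\<Sum>k = 0..<m * m. X $$ (i, k) * ?E $$ (k, 0))"
        using X i by (auto simp: scalar_prod_def e_def intro!: sum.cong)
      also have "\<dots> = (\<Sum>k = 0..<m * m. if k = j then X $$ (i, k) else 0)"
        by (intro sum.cong) (auto simp: E)
      also have "\<dots> = X $$ (i, j)" using j by simp
      finally show ?thesis .
    qed
    have "S * ?E = T * ?E"
      using S T by (simp add: is_tensor_commutation_mat_def e_def)
    then show "S $$ (i, j) = T $$ (i, j)" using col[OF c(1)] col[OF c(2)] by metis
  qed (use c in auto)
qed

end

theory Submission
  imports Defs
begin

text \<open>
  The \<open>((a, c), (b, d))\<close> entry of the commutation matrix is 1 iff \<open>a = d\<close> and \<open>c = b\<close>. For \<open>2 \<times> 2\<close>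
  matrices the sum of all \<open>\<sigma>\<^sub>k(a, b) \<sigma>\<^sub>k(c, d)\<close> is twice that indicator (completeness of the Pauli
  basis). Entries of Kronecker products factor, so the sum over all words of length \<open>n\<close> is the
  \<open>n\<close>-fold product of such sums, that is, \<open>2\<^sup>n\<close> times the indicator for indices below \<open>2\<^sup>n\<close>.
\<close>

lemma tensor_commutation_mat_is_tensor_commutation_mat:
  "is_tensor_commutation_mat m (tensor_commutation_mat m)"
  unfolding tensor_commutation_mat_def by (rule theI'[OF ex1_tensor_commutation_mat])

lemma tensor_commutation_mat_carrier:
  "tensor_commutation_mat m \<in> carrier_mat (m * m) (m * m)"
  using tensor_commutation_mat_is_tensor_commutation_mat[of m]
  by (auto simp: is_tensor_commutation_mat_def is_permutation_mat_def power2_eq_square)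

text \<open>An index below \<open>m * l\<close> is determined by its quotient and remainder modulo
  \<open>l\<close>, so the Kronecker product of the two unit vectors is the unit vector at
  \<open>j\<close>. Multiplying by it extracts column \<open>j\<close> of \<open>X\<close>.\<close>

lemma index_mult_unit_kronecker:
  assumes X: "X \<in> carrier_mat r (m * l)" and i: "i < r" and j: "j < m * l"
  shows "(X * (mat m 1 (\<lambda>(k, _). of_bool (k = j div l)) \<otimes>\<^sub>m
               mat l 1 (\<lambda>(k, _). of_bool (k = j mod l)))) $$ (i, 0) = X $$ (i, j)"
    (is "(X * ?E) $$ _ = _")
proof -
  have l: "l > 0" using j by (auto intro!: Nat.gr0I)
  have E: "?E $$ (k, 0) = of_bool (k = j)" if "k < m * l" for k
  proof -
    have "k = j \<longleftrightarrow> k div l = j div l \<and> k mod l = j mod l" by (metis div_mult_mod_eq)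
    then show ?thesis
      using that l by (auto simp: kronecker_index less_mult_imp_div_less)
  qed
  have "(X * ?E) $$ (i, 0) = (\<Sum>k = 0..<m * l. X $$ (i, k) * ?E $$ (k, 0))"
    using X i by (auto simp: scalar_prod_def intro!: sum.cong)
  also have "\<dots> = (\<Sum>k = 0..<m * l. if k = j then X $$ (i, k) else 0)"
    by (intro sum.cong refl) (subst E; simp)
  finally show ?thesis using j by simp
qed

text \<open>Column \<open>j\<close> is the image of the unit vector at \<open>j\<close>, which is a
  product of two unit vectors. The defining property swaps these factors, and the entries of the
  swapped product can be read off.\<close>

lemma tensor_commutation_mat_index:
  assumes i: "i < m * m" and j: "j < m * m"
  shows "tensor_commutation_mat m $$ (i, j) = of_bool (i div m = j mod m \<and> i mod m = j div m)"
proof -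
  define e :: "nat \<Rightarrow> complex mat" where "e k = mat m 1 (\<lambda>(i, _). of_bool (i = k))" for k
  have m: "m > 0" using j by (auto intro!: Nat.gr0I)
  have "tensor_commutation_mat m $$ (i, j) =
      (tensor_commutation_mat m * (e (j div m) \<otimes>\<^sub>m e (j mod m))) $$ (i, 0)"
    unfolding e_def
    by (rule index_mult_unit_kronecker[OF tensor_commutation_mat_carrier i j, symmetric])
  also have "tensor_commutation_mat m * (e (j div m) \<otimes>\<^sub>m e (j mod m)) =
      e (j mod m) \<otimes>\<^sub>m e (j div m)"
    using tensor_commutation_mat_is_tensor_commutation_mat[of m]
    by (simp add: is_tensor_commutation_mat_def e_def)
  also have "\<dots> $$ (i, 0) = of_bool (i div m = j mod m \<and> i mod m = j div m)"
    using i m by (auto simp: kronecker_index e_def less_mult_imp_div_less)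
  finally show ?thesis .
qed

lemma pauli_index:
  assumes "a < 2" "b < 2"
  shows "pauli 0 $$ (a, b) = of_bool (a = b)"
    and "pauli 1 $$ (a, b) = of_bool (a \<noteq> b)"
    and "pauli 2 $$ (a, b) = of_bool (a \<noteq> b) * (if a = 0 then - \<i> else \<i>)"
    and "pauli 3 $$ (a, b) = of_bool (a = b) * (if a = 0 then 1 else - 1)"
proof -
  have "a \<in> {0, 1}" "b \<in> {0, 1}" using assms by auto
  then show "pauli 0 $$ (a, b) = of_bool (a = b)"
    and "pauli 1 $$ (a, b) = of_bool (a \<noteq> b)"
    and "pauli 2 $$ (a, b) = of_bool (a \<noteq> b) * (if a = 0 then - \<i> else \<i>)"
    and "pauli 3 $$ (a, b) = of_bool (a = b) * (if a = 0 then 1 else - 1)"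
    by (elim insertE emptyE; simp add: pauli_def mat_of_rows_list_def)+
qed

text \<open>If \<open>a = b\<close> and \<open>c = d\<close>, only indices 0 and 3 contribute,
  giving 1 plus a sign that is positive iff \<open>a = c\<close>. If \<open>a \<noteq> b\<close> and
  \<open>c \<noteq> d\<close>, only 1 and 2 contribute, and \<open>\<i>\<close> squared makes the
  sign positive iff \<open>a \<noteq> c\<close>, that is, \<open>a = d\<close>. In the mixed cases
  every term vanishes.\<close>

lemma sum_pauli_index:
  assumes "a < 2" "b < 2" "c < 2" "d < 2"
  shows "(\<Sum>k = 0..3. pauli k $$ (a, b) * pauli k $$ (c, d)) = 2 * of_bool (a = d \<and> c = b)"
proof -
  have "(\<Sum>k = 0..3. pauli k $$ (a, b) * pauli k $$ (c, d)) =
      (\<Sum>k\<in>{0, 1, 2, 3}. pauli k $$ (a, b) * pauli k $$ (c, d))"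
    by (rule sum.cong) auto
  also have "\<dots> = pauli 0 $$ (a, b) * pauli 0 $$ (c, d) + pauli 1 $$ (a, b) * pauli 1 $$ (c, d) +
      pauli 2 $$ (a, b) * pauli 2 $$ (c, d) + pauli 3 $$ (a, b) * pauli 3 $$ (c, d)"
    by simp
  also have "\<dots> = 2 * of_bool (a = d \<and> c = b)"
  proof -
    have "a \<in> {0, 1}" "b \<in> {0, 1}" "c \<in> {0, 1}" "d \<in> {0, 1}" using assms by auto
    then show ?thesis
      unfolding pauli_index[OF assms(1,2)] pauli_index[OF assms(3,4)]
      by (elim insertE emptyE; simp)
  qed
  finally show ?thesis .
qed

text \<open>Splitting a nonempty word into head and tail is a bijection; this drives the induction
  on word length.\<close>

lemma sum_lists_length_Suc:
  "(\<Sum>xs | set xs \<subseteq> A \<and> length xs = Suc n. f xs) =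
   (\<Sum>x\<in>A. \<Sum>xs | set xs \<subseteq> A \<and> length xs = n. f (x # xs))"
proof -
  have "(\<Sum>xs | set xs \<subseteq> A \<and> length xs = Suc n. f xs) =
      (\<Sum>(x, xs)\<in>A \<times> {xs. set xs \<subseteq> A \<and> length xs = n}. f (x # xs))"
    by (rule sum.reindex_bij_witness[where i = "\<lambda>(x, xs). x # xs" and j = "\<lambda>xs. (hd xs, tl xs)"])
      (auto simp: length_Suc_conv)
  then show ?thesis by (simp add: sum.cartesian_product)
qed

lemma sum_kronecker_list_pauli_index:
  assumes "a < 2 ^ n" "b < 2 ^ n" "c < 2 ^ n" "d < 2 ^ n"
  shows "(\<Sum>ks | set ks \<subseteq> {0..3} \<and> length ks = n.
      kronecker_list (map pauli ks) $$ (a, b) * kronecker_list (map pauli ks) $$ (c, d)) =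
    2 ^ n * of_bool (a = d \<and> c = b)"
  using assms
proof (induction n arbitrary: a b c d)
  \<comment> \<open>The empty word gives the 1 by 1 identity, and all four indices are 0.\<close>
  case 0
  have "{ks. set ks \<subseteq> {0..3::nat} \<and> length ks = 0} = {[]}" by auto
  with 0 show ?case by simp
next
  case (Suc n)
  let ?W = "{ks. set ks \<subseteq> {0..3::nat} \<and> length ks = n}"
  let ?K = "\<lambda>ks. kronecker_list (map pauli ks)"
  let ?m = "2 ^ n :: nat"
  \<comment> \<open>In binary, the first factor sees the leading digit of each index and the
    remaining factors see the last \<open>n\<close> digits.\<close>
  have idx: "?K (k # ks) $$ (x, y) =
      pauli k $$ (x div ?m, y div ?m) * ?K ks $$ (x mod ?m, y mod ?m)"
    if "k \<in> {0..3}" "ks \<in> ?W" "x < 2 ^ Suc n" "y < 2 ^ Suc n" for k ks x y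
    using that pauli_carrier[of k] kronecker_list_pauli_carrier[of ks]
    by (auto simp: kronecker_index)
  have div_less: "x div ?m < 2" if "x < 2 ^ Suc n" for x
    using that by (simp add: less_mult_imp_div_less)
  have mod_less: "x mod ?m < ?m" for x by simp
  \<comment> \<open>This merges the indicators for leading digits and for remainders into one
    indicator for whole indices.\<close>
  have eq: "x = y \<longleftrightarrow> x div ?m = y div ?m \<and> x mod ?m = y mod ?m" for x y
    by (metis div_mult_mod_eq)
  have "(\<Sum>ks | set ks \<subseteq> {0..3} \<and> length ks = Suc n. ?K ks $$ (a, b) * ?K ks $$ (c, d)) =
      (\<Sum>k = 0..3. \<Sum>ks\<in>?W. ?K (k # ks) $$ (a, b) * ?K (k # ks) $$ (c, d))"
    by (rule sum_lists_length_Suc)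
  also have "\<dots> = (\<Sum>k = 0..3. \<Sum>ks\<in>?W.
      (pauli k $$ (a div ?m, b div ?m) * pauli k $$ (c div ?m, d div ?m)) *
      (?K ks $$ (a mod ?m, b mod ?m) * ?K ks $$ (c mod ?m, d mod ?m)))"
    by (intro sum.cong refl) (simp only: idx Suc.prems mult_ac)
  \<comment> \<open>Each summand is a factor depending on \<open>k\<close> alone times one depending
    on \<open>ks\<close> alone, so the double sum splits.\<close>
  also have "\<dots> =
      (\<Sum>k = 0..3. pauli k $$ (a div ?m, b div ?m) * pauli k $$ (c div ?m, d div ?m)) *
      (\<Sum>ks\<in>?W. ?K ks $$ (a mod ?m, b mod ?m) * ?K ks $$ (c mod ?m, d mod ?m))"
    by (rule sum_product[symmetric])
  also have "\<dots> = (2 * of_bool (a div ?m = d div ?m \<and> c div ?m = b div ?m)) *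
      (2 ^ n * of_bool (a mod ?m = d mod ?m \<and> c mod ?m = b mod ?m))"
    by (simp only: sum_pauli_index div_less mod_less Suc.IH Suc.prems)
  also have "\<dots> = 2 ^ Suc n * of_bool (a = d \<and> c = b)"
    by (simp add: eq[of a d] eq[of c b])
  finally show ?case .
qed

lemma finsum_module_mat_carrier:
  assumes "f \<in> A \<rightarrow> carrier_mat r c"
  shows "finsum (module_mat TYPE('a :: comm_ring_1) r c) f A \<in> carrier_mat r c"
proof -
  interpret abelian_group "module_mat TYPE('a) r c" by (rule abelian_group_mat)
  show ?thesis using finsum_closed[of f A] assms by (simp add: module_mat_simps)
qed

text \<open>Addition in \<open>module_mat\<close> is entrywise, so the matrix identity reduces to
  ordinary sums of entries. Closure of the partial sums supplies the dimensions needed to index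
  them.\<close>

lemma finsum_module_mat_index:
  assumes "finite A" "f \<in> A \<rightarrow> carrier_mat r c" "i < r" "j < c"
  shows "finsum (module_mat TYPE('a :: comm_ring_1) r c) f A $$ (i, j) = (\<Sum>x\<in>A. f x $$ (i, j))"
proof -
  interpret abelian_group "module_mat TYPE('a) r c" by (rule abelian_group_mat)
  show ?thesis
    using assms(1,2)
  proof (induction A rule: finite_induct)
    case empty
    show ?case using assms(3,4) by (simp add: module_mat_simps)
  next
    case (insert x A)
    then have "f x \<in> carrier_mat r c" "f \<in> A \<rightarrow> carrier_mat r c" by auto
    moreover from this have "finsum (module_mat TYPE('a) r c) f A \<in> carrier_mat r c"
      by (intro finsum_module_mat_carrier)
    ultimately show ?case
      using insert assms(3,4) by (simp add: finsum_insert module_mat_simps)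
  qed
qed

theorem proposition3:
  fixes n :: nat
  assumes "n \<ge> 2"
  shows "tensor_commutation_mat (2 ^ n) =
    (1 / 2 ^ n) \<cdot>\<^sub>m
      finsum (module_mat TYPE(complex) (2 ^ n * 2 ^ n) (2 ^ n * 2 ^ n))
        (\<lambda>ks. kronecker_list (map pauli ks) \<otimes>\<^sub>m kronecker_list (map pauli ks))
        {ks. set ks \<subseteq> {0..3} \<and> length ks = n}"
    (is "?S = (1 / 2 ^ n) \<cdot>\<^sub>m ?F")
proof (rule eq_matI)
  let ?m = "2 ^ n :: nat"
  let ?K = "\<lambda>ks. kronecker_list (map pauli ks)"
  let ?W = "{ks. set ks \<subseteq> {0..3::nat} \<and> length ks = n}"
  have K: "?K ks \<in> carrier_mat ?m ?m" if "ks \<in> ?W" for ks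
    using that kronecker_list_pauli_carrier[of ks] by auto
  then have KK: "(\<lambda>ks. ?K ks \<otimes>\<^sub>m ?K ks) \<in> ?W \<rightarrow> carrier_mat (?m * ?m) (?m * ?m)"
    by (blast intro: kronecker_carrier)
  have F: "?F \<in> carrier_mat (?m * ?m) (?m * ?m)"
    by (rule finsum_module_mat_carrier[OF KK])
  show "dim_row ?S = dim_row ((1 / 2 ^ n) \<cdot>\<^sub>m ?F)" "dim_col ?S = dim_col ((1 / 2 ^ n) \<cdot>\<^sub>m ?F)"
    using F tensor_commutation_mat_carrier[of ?m] by auto
  fix i j assume "i < dim_row ((1 / 2 ^ n) \<cdot>\<^sub>m ?F)" "j < dim_col ((1 / 2 ^ n) \<cdot>\<^sub>m ?F)"
  then have i: "i < ?m * ?m" and j: "j < ?m * ?m" using F by auto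
  have fin: "finite ?W" by (rule finite_lists_length_eq) simp
  have "?F $$ (i, j) = (\<Sum>ks\<in>?W. (?K ks \<otimes>\<^sub>m ?K ks) $$ (i, j))"
    by (rule finsum_module_mat_index[OF fin KK i j])
  also have "\<dots> =
      (\<Sum>ks\<in>?W. ?K ks $$ (i div ?m, j div ?m) * ?K ks $$ (i mod ?m, j mod ?m))"
  proof (intro sum.cong refl)
    fix ks assume "ks \<in> ?W"
    from K[OF this] show "(?K ks \<otimes>\<^sub>m ?K ks) $$ (i, j) =
        ?K ks $$ (i div ?m, j div ?m) * ?K ks $$ (i mod ?m, j mod ?m)"
      using i j by (subst kronecker_index) auto
  qed
  \<comment> \<open>Here the quotients of \<open>i\<close> and \<open>j\<close> act as
    \<open>a\<close> and \<open>b\<close>, the remainders as \<open>c\<close> and \<open>d\<close>.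
    The result is \<open>2 ^ n\<close> times the entry of the commutation matrix, and the scalar in
    front cancels that power.\<close>
  also have "\<dots> = 2 ^ n * of_bool (i div ?m = j mod ?m \<and> i mod ?m = j div ?m)"
    using i j by (intro sum_kronecker_list_pauli_index) (auto simp: less_mult_imp_div_less)
  finally show "?S $$ (i, j) = ((1 / 2 ^ n) \<cdot>\<^sub>m ?F) $$ (i, j)"
    using F i j by (simp add: tensor_commutation_mat_index)
qed

end
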